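(* Let $r\in\mathbb{R}^3$ be a reward vector with $r(1)>r(2)>r(3)$ and let $X\in\mathbb{R}^{3\times d}$ be a feature matrix with rows $x_1,x_2,x_3$. Assume there exists $w\in\mathbb{R}^d$ such that $r'=Xw$ satisfies, for all $i,j$, $r'(i)>r'(j)$ if and only if $r(i)>r(j)$, and assume that the condition $\langle x_2-x_3,\,x_1-x_3\rangle>0$ is not satisfied, i.e. $\langle x_2-x_3,\,x_1-x_3\rangle\le 0$. Let the initialization be $\theta_1=C\,(x_3-x_1)$ with $C$ such that $$C>\frac{-\log(\zeta)}{\|x_3-x_1\|_2^2},\qquad\text{where}\quad \zeta:=\frac{\langle x_3-x_2,\,x_1-x_3\rangle}{\langle x_1-x_2,\,x_1-x_3\rangle}\cdot\frac{\langle\pi_{\theta_1},r\rangle-r(3)}{r(1)-\langle\pi_{\theta_1},r\rangle}.$$ Let $\eta$ be a constant with $0<\eta<\frac{4}{9\,R_{\max}\,\lambda_{\max}(X^\top X)}$, and for $t\ge1$ let $\theta_{t+1}=\theta_t+\eta\,X^\top(\mathrm{diag}(\pi_{\theta_t})-\pi_{\theta_t}\pi_{\theta_t}^\top)\,r$. Then this algorithm fails to converge to the optimal policy, i.e. $\pi_{\theta_t}(1)$ does not converge to $1$ as $t\to\infty$.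
   Context: Rewards lie in $[-R_{\max},R_{\max}]$ with $R_{\max}>0$. For $\theta\in\mathbb{R}^d$, $\pi_\theta=\mathrm{softmax}(X\theta)$, i.e. $\pi_\theta(a)=\exp(\langle x_a,\theta\rangle)/\sum_{a'=1}^{3}\exp(\langle x_{a'},\theta\rangle)$. $\lambda_{\max}(M)$ denotes the largest eigenvalue of $M$. The optimal policy puts all its probability mass on action $1$, the action with the largest reward. The quantity $\zeta$ depends on $C$ through $\theta_1$. *)

theory Defs
  imports "HOL-Analysis.Analysis"
begin

definition softmax :: "real ^ 'n \<Rightarrow> real ^ 'n" where
  "softmax z = (\<chi> a. exp (z $ a) / (\<Sum>b\<in>UNIV. exp (z $ b)))"

definition policy :: "real ^ 'd ^ 'n \<Rightarrow> real ^ 'd \<Rightarrow> real ^ 'n" where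
  "policy X \<theta> = softmax (X *v \<theta>)"

definition diag :: "real ^ 'n \<Rightarrow> real ^ 'n ^ 'n" where
  "diag v = (\<chi> i j. if i = j then v $ i else 0)"

definition is_eigenvalue :: "real ^ 'n ^ 'n \<Rightarrow> real \<Rightarrow> bool" where
  "is_eigenvalue M k \<longleftrightarrow> (\<exists>v. v \<noteq> 0 \<and> M *v v = k *\<^sub>R v)"

(* Only meaningful when M has a largest real eigenvalue, as every symmetric M does. *)
definition lambda_max :: "real ^ 'n ^ 'n \<Rightarrow> real" where
  "lambda_max M = (GREATEST k. is_eigenvalue M k)"

definition outer :: "real ^ 'n \<Rightarrow> real ^ 'm \<Rightarrow> real ^ 'm ^ 'n" where
  "outer u v = (\<chi> i j. u $ i * v $ j)"

definition pg_step :: "real \<Rightarrow> real ^ 'd ^ 'n \<Rightarrow> real ^ 'n \<Rightarrow> real ^ 'd \<Rightarrow> real ^ 'd" where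
  "pg_step \<eta> X r \<theta> =
     (let p = policy X \<theta>
      in \<theta> + \<eta> *\<^sub>R (transpose X *v ((diag p - outer p p) *v r)))"

end

theory Submission
  imports Defs
begin

text \<open>With \<open>u = x\<^sub>1 - x\<^sub>3\<close> and \<open>J = \<langle>\<pi>, r\<rangle>\<close>, the gradient \<open>g\<close> satisfies
  \<open>\<langle>g, u\<rangle> = \<pi>\<^sub>1 (r\<^sub>1 - J) \<langle>x\<^sub>1 - x\<^sub>2, u\<rangle> - \<pi>\<^sub>3 (J - r\<^sub>3) \<langle>x\<^sub>3 - x\<^sub>2, u\<rangle>\<close>, which is nonpositive as
  soon as \<open>\<pi>\<^sub>1 / \<pi>\<^sub>3 = exp \<langle>u, \<theta>\<rangle>\<close> is at most the quantity \<open>\<zeta>\<close> evaluated at \<open>\<theta>\<close>. The condition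
  on \<open>C\<close> says that this holds at \<open>\<theta>\<^sub>1\<close>. The second derivative of \<open>\<langle>softmax, r\<rangle>\<close> in a direction \<open>y\<close> is
  at most \<open>2 R\<^sub>m\<^sub>a\<^sub>x \<parallel>y\<parallel>\<^sup>2\<close>, so a step of size \<open>\<eta>\<close> never decreases \<open>J\<close>, nor therefore \<open>\<zeta>\<close>. Hence
  \<open>\<langle>u, \<theta>\<^sub>t\<rangle>\<close> never increases and \<open>\<pi>\<^sub>1 / \<pi>\<^sub>3\<close> stays bounded.\<close>

section \<open>Softmax along a line\<close>

lemma sum_exp_pos: "(\<Sum>b\<in>UNIV. exp (z $ b :: real)) > 0"
  by (intro sum_pos) auto

lemma softmax_pos: "softmax z $ a > 0"
  by (simp add: softmax_def sum_exp_pos)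

lemma sum_softmax: "(\<Sum>a\<in>UNIV. softmax z $ a) = 1"
  using sum_exp_pos[of z] by (simp add: softmax_def flip: sum_divide_distrib)

lemma softmax_le_1: "softmax z $ a \<le> 1"
proof -
  have "softmax z $ a \<le> (\<Sum>a\<in>UNIV. softmax z $ a)"
    by (rule member_le_sum) (auto intro: less_imp_le softmax_pos)
  then show ?thesis by (simp add: sum_softmax)
qed

lemma softmax_ratio: "softmax z $ a = exp (z $ a - z $ b) * softmax z $ b"
  by (simp add: softmax_def exp_diff)

lemma softmax_inner: "softmax z \<bullet> f = (\<Sum>a\<in>UNIV. f $ a * exp (z $ a)) / (\<Sum>a\<in>UNIV. exp (z $ a))"
  by (simp add: softmax_def inner_vec_def sum_divide_distrib mult.commute)

lemma abs_softmax_inner_le: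
  assumes "\<And>a. \<bar>f $ a\<bar> \<le> B"
  shows "\<bar>softmax z \<bullet> f\<bar> \<le> B"
proof -
  have "\<bar>softmax z \<bullet> f\<bar> \<le> (\<Sum>a\<in>UNIV. \<bar>softmax z $ a * f $ a\<bar>)"
    by (simp add: inner_vec_def)
  also have "\<dots> \<le> (\<Sum>a\<in>UNIV. softmax z $ a * B)"
    using assms by (intro sum_mono) (simp add: abs_mult abs_of_pos[OF softmax_pos]
        mult_left_mono[OF _ less_imp_le[OF softmax_pos]])
  also have "\<dots> = B"
    by (simp add: sum_softmax flip: sum_distrib_right)
  finally show ?thesis .
qed

text \<open>The quotient rule yields the covariance of \<open>f\<close> and \<open>y\<close> under
  \<open>p s\<close>. This is again a polynomial in terms of the form
  \<open>p s \<bullet> h\<close>, so the lemma can be applied a second time to get the second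
  derivative.\<close>

lemma softmax_line_has_derivative:
  fixes z y f :: "real ^ 'n"
  defines "p \<equiv> \<lambda>s. softmax (z + s *\<^sub>R y)"
  shows "((\<lambda>s. p s \<bullet> f) has_real_derivative (p s \<bullet> (f * y) - (p s \<bullet> f) * (p s \<bullet> y))) (at s)"
proof -
  let ?e = "\<lambda>s a. exp (z $ a + s * y $ a)"
  have D: "(\<Sum>a\<in>UNIV. ?e s a) > 0"
    by (intro sum_pos) auto
  have "((\<lambda>s. (\<Sum>a\<in>UNIV. f $ a * ?e s a) / (\<Sum>a\<in>UNIV. ?e s a)) has_real_derivative
      ((\<Sum>a\<in>UNIV. (f * y) $ a * ?e s a) * (\<Sum>a\<in>UNIV. ?e s a)
       - (\<Sum>a\<in>UNIV. f $ a * ?e s a) * (\<Sum>a\<in>UNIV. y $ a * ?e s a))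
      / ((\<Sum>a\<in>UNIV. ?e s a) * (\<Sum>a\<in>UNIV. ?e s a))) (at s)"
    using D by (auto intro!: derivative_eq_intros sum.cong arg_cong2[of _ _ _ _ "(-)"]
        arg_cong2[of _ _ _ _ "(*)"] simp: algebra_simps)
  moreover have "(N * T - F * Y) / (T * T) = N / T - F / T * (Y / T)" if "T > 0" for N F Y T :: real
    using that by (simp add: field_simps)
  moreover have "p s \<bullet> h = (\<Sum>a\<in>UNIV. h $ a * ?e s a) / (\<Sum>a\<in>UNIV. ?e s a)" for s h
    by (simp add: p_def softmax_inner)
  ultimately show ?thesis
    using D by simp
qed

text \<open>The expression inside the absolute value is the second derivative of \<open>\<lambda>s. softmax (z + s *\<^sub>R y) \<bullet> r\<close>,
  which equals \<open>\<langle>p, (r - \<langle>p, r\<rangle>) (y - \<langle>p, y\<rangle>)\<^sup>2\<rangle>\<close>.\<close>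

lemma softmax_third_cumulant_le:
  fixes r y z :: "real ^ 'n"
  assumes r: "\<And>a. \<bar>r $ a\<bar> \<le> R"
  defines "p \<equiv> softmax z"
  shows "\<bar>p \<bullet> (r * y * y) - (p \<bullet> (r * y)) * (p \<bullet> y)
      - ((p \<bullet> (r * y) - (p \<bullet> r) * (p \<bullet> y)) * (p \<bullet> y)
         + (p \<bullet> (y * y) - (p \<bullet> y) * (p \<bullet> y)) * (p \<bullet> r))\<bar> \<le> 2 * R * (norm y)\<^sup>2"
    (is "\<bar>?c\<bar> \<le> _")
proof -
  define \<rho> m where "\<rho> = p \<bullet> r" and "m = p \<bullet> y"
  have p1: "sum (($) p) UNIV = 1"
    using sum_softmax[of z] by (simp add: p_def)
  have p0: "p $ a \<ge> 0" for a
    by (simp add: p_def less_imp_le softmax_pos)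
  have sum_p: "(\<Sum>a\<in>UNIV. p $ a * f $ a) = p \<bullet> f" for f
    by (simp add: inner_vec_def)
  have "R \<ge> 0"
    using r[of undefined] by linarith
  have \<rho>: "\<bar>\<rho>\<bar> \<le> R"
    unfolding \<rho>_def p_def by (rule abs_softmax_inner_le[OF r])
  have c: "?c = (\<Sum>a\<in>UNIV. p $ a * ((r $ a - \<rho>) * (y $ a - m)\<^sup>2))"
  proof -
    have "(\<Sum>a\<in>UNIV. p $ a * ((r $ a - \<rho>) * (y $ a - m)\<^sup>2))
      = (\<Sum>a\<in>UNIV. p $ a * (r * y * y) $ a - 2 * m * (p $ a * (r * y) $ a) + m\<^sup>2 * (p $ a * r $ a)
         - \<rho> * (p $ a * (y * y) $ a) + 2 * \<rho> * m * (p $ a * y $ a) - \<rho> * m\<^sup>2 * p $ a)"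
      by (intro sum.cong) (auto simp: algebra_simps power2_eq_square)
    also have "\<dots> = p \<bullet> (r * y * y) - 2 * m * (p \<bullet> (r * y)) + m\<^sup>2 * \<rho>
         - \<rho> * (p \<bullet> (y * y)) + 2 * \<rho> * m * m - \<rho> * m\<^sup>2"
      by (simp only: sum.distrib sum_subtractf p1 sum_p \<rho>_def m_def mult_1_right flip: sum_distrib_left)
    finally show ?thesis
      by (simp add: \<rho>_def m_def algebra_simps power2_eq_square)
  qed
  have v: "(\<Sum>a\<in>UNIV. p $ a * (y $ a - m)\<^sup>2) = (\<Sum>a\<in>UNIV. p $ a * (y $ a)\<^sup>2) - m\<^sup>2"
  proof -
    have "(\<Sum>a\<in>UNIV. p $ a * (y $ a - m)\<^sup>2)
        = (\<Sum>a\<in>UNIV. p $ a * (y $ a)\<^sup>2 - 2 * m * (p $ a * y $ a) + m\<^sup>2 * p $ a)"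
      by (intro sum.cong) (auto simp: algebra_simps power2_eq_square)
    also have "\<dots> = (\<Sum>a\<in>UNIV. p $ a * (y $ a)\<^sup>2) - 2 * m * m + m\<^sup>2"
      by (simp only: sum.distrib sum_subtractf p1 sum_p m_def mult_1_right flip: sum_distrib_left)
    finally show ?thesis by (simp add: power2_eq_square)
  qed
  have y2: "(\<Sum>a\<in>UNIV. p $ a * (y $ a)\<^sup>2) \<le> (norm y)\<^sup>2"
  proof -
    have "(\<Sum>a\<in>UNIV. p $ a * (y $ a)\<^sup>2) \<le> (\<Sum>a\<in>UNIV. 1 * (y $ a)\<^sup>2)"
      by (intro sum_mono mult_right_mono) (auto simp: p_def softmax_le_1)
    also have "\<dots> = (norm y)\<^sup>2"
      unfolding power2_norm_eq_inner by (simp add: inner_vec_def power2_eq_square)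
    finally show ?thesis .
  qed
  \<comment> \<open>Bounding \<open>r $ a - \<rho>\<close> costs the factor \<open>2 * R\<close>.
    What remains is the variance of \<open>y\<close>, hence at most its second moment, and every
    probability is at most 1.\<close>
  have "\<bar>?c\<bar> \<le> (\<Sum>a\<in>UNIV. \<bar>p $ a * ((r $ a - \<rho>) * (y $ a - m)\<^sup>2)\<bar>)"
    unfolding c by (rule sum_abs)
  also have "\<dots> \<le> (\<Sum>a\<in>UNIV. 2 * R * (p $ a * (y $ a - m)\<^sup>2))"
  proof (rule sum_mono)
    fix a
    have "\<bar>r $ a - \<rho>\<bar> \<le> 2 * R"
      using r[of a] \<rho> by linarith
    then have "\<bar>r $ a - \<rho>\<bar> * (p $ a * (y $ a - m)\<^sup>2) \<le> 2 * R * (p $ a * (y $ a - m)\<^sup>2)"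
      using p0 by (intro mult_right_mono) auto
    then show "\<bar>p $ a * ((r $ a - \<rho>) * (y $ a - m)\<^sup>2)\<bar> \<le> 2 * R * (p $ a * (y $ a - m)\<^sup>2)"
      using p0[of a] by (simp add: abs_mult mult_ac)
  qed
  also have "\<dots> = 2 * R * ((\<Sum>a\<in>UNIV. p $ a * (y $ a)\<^sup>2) - m\<^sup>2)"
    by (simp add: v flip: sum_distrib_left)
  also have "\<dots> \<le> 2 * R * (norm y)\<^sup>2"
  proof (rule mult_left_mono)
    show "(\<Sum>a\<in>UNIV. p $ a * (y $ a)\<^sup>2) - m\<^sup>2 \<le> (norm y)\<^sup>2"
      using y2 zero_le_power2[of m] by linarith
  qed (use \<open>R \<ge> 0\<close> in simp)
  finally show ?thesis .
qed

text \<open>\<open>cov\<close> is the slope of the expected reward along the line, so the mean value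
  theorem turns the second-derivative bound into a Lipschitz bound for the slope.\<close>

lemma softmax_covariance_line_le:
  fixes r y z :: "real ^ 'n"
  assumes r: "\<And>a. \<bar>r $ a\<bar> \<le> R" and "s \<ge> 0"
  defines "cov \<equiv> \<lambda>s. softmax (z + s *\<^sub>R y) \<bullet> (r * y)
      - (softmax (z + s *\<^sub>R y) \<bullet> r) * (softmax (z + s *\<^sub>R y) \<bullet> y)"
  shows "\<bar>cov s - cov 0\<bar> \<le> s * (2 * R * (norm y)\<^sup>2)"
proof (cases "s = 0")
  case False
  let ?p = "\<lambda>s. softmax (z + s *\<^sub>R y)"
  \<comment> \<open>Written exactly as the product rule returns it, which is also the form bounded
    in \<open>softmax_third_cumulant_le\<close>.\<close>
  let ?D = "\<lambda>t. ?p t \<bullet> (r * y * y) - (?p t \<bullet> (r * y)) * (?p t \<bullet> y)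
      - ((?p t \<bullet> (r * y) - (?p t \<bullet> r) * (?p t \<bullet> y)) * (?p t \<bullet> y)
         + (?p t \<bullet> (y * y) - (?p t \<bullet> y) * (?p t \<bullet> y)) * (?p t \<bullet> r))"
  have "(cov has_real_derivative ?D t) (at t)" for t
    unfolding cov_def by (intro DERIV_diff DERIV_mult softmax_line_has_derivative)
  moreover have "0 < s"
    using False \<open>s \<ge> 0\<close> by simp
  ultimately obtain t where "cov s - cov 0 = (s - 0) * ?D t"
    using MVT2[of 0 s cov ?D] by blast
  then show ?thesis
    using mult_left_mono[OF softmax_third_cumulant_le[OF r, of "z + t *\<^sub>R y" y] \<open>s \<ge> 0\<close>] \<open>s \<ge> 0\<close>
    by (simp only: abs_mult abs_of_nonneg diff_zero)
qed simp

lemma softmax_gradient_nth: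
  fixes p r :: "real ^ 'n"
  shows "((diag p - outer p p) *v r) $ a = p $ a * (r $ a - p \<bullet> r)"
proof -
  have "(diag p *v r) $ a = p $ a * r $ a"
    by (simp add: matrix_vector_mult_def diag_def if_distrib[of "\<lambda>x. x * _"] cong: if_cong)
  moreover have "(outer p p *v r) $ a = p $ a * (p \<bullet> r)"
    by (simp add: matrix_vector_mult_def outer_def inner_vec_def sum_distrib_left mult.assoc)
  ultimately show ?thesis
    by (simp add: matrix_vector_mult_diff_rdistrib right_diff_distrib)
qed

text \<open>Links the matrix form of the gradient to the covariance form of the slope in
  \<open>softmax_line_has_derivative\<close>.\<close>

lemma softmax_gradient_inner:
  fixes p r :: "real ^ 'n"
  shows "((diag p - outer p p) *v r) \<bullet> y = p \<bullet> (r * y) - (p \<bullet> r) * (p \<bullet> y)"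
proof -
  have "((diag p - outer p p) *v r) \<bullet> y = (\<Sum>a\<in>UNIV. p $ a * (r * y) $ a - (p \<bullet> r) * (p $ a * y $ a))"
    unfolding inner_vec_def[of "_ *v _"] softmax_gradient_nth by (simp add: algebra_simps)
  moreover have "(\<Sum>a\<in>UNIV. p $ a * f $ a) = p \<bullet> f" for f
    by (simp add: inner_vec_def)
  ultimately show ?thesis
    by (simp only: sum_subtractf flip: sum_distrib_left)
qed

text \<open>The gain is \<open>\<eta>\<close> times the slope at some \<open>s < \<eta>\<close>.
  That slope differs from the one at 0 by at most
  \<open>\<eta> * (2 * R * (norm y)\<^sup>2)\<close>, which by hypothesis does not exceed the slope
  at 0.\<close>

lemma softmax_ascent:
  fixes r y z :: "real ^ 'n"
  assumes r: "\<And>a. \<bar>r $ a\<bar> \<le> R" and "\<eta> > 0"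
    and y: "\<eta> * (2 * R * (norm y)\<^sup>2) \<le> ((diag (softmax z) - outer (softmax z) (softmax z)) *v r) \<bullet> y"
  shows "softmax z \<bullet> r \<le> softmax (z + \<eta> *\<^sub>R y) \<bullet> r"
proof -
  let ?p = "\<lambda>s. softmax (z + s *\<^sub>R y)"
  let ?c = "\<lambda>s. ?p s \<bullet> (r * y) - (?p s \<bullet> r) * (?p s \<bullet> y)"
  obtain s where s: "0 < s" "s < \<eta>" "?p \<eta> \<bullet> r - ?p 0 \<bullet> r = (\<eta> - 0) * ?c s"
    using MVT2[OF \<open>\<eta> > 0\<close> softmax_line_has_derivative[of z y r]] by blast
  have "R \<ge> 0"
    using r[of undefined] by linarith
  then have "s * (2 * R * (norm y)\<^sup>2) \<le> \<eta> * (2 * R * (norm y)\<^sup>2)"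
    using s by (intro mult_right_mono) auto
  moreover have "?c 0 = ((diag (softmax z) - outer (softmax z) (softmax z)) *v r) \<bullet> y"
    by (simp add: softmax_gradient_inner)
  ultimately have "?c s \<ge> 0"
    using softmax_covariance_line_le[OF r, of s z y] s y by linarith
  then have "(\<eta> - 0) * ?c s \<ge> 0"
    using \<open>\<eta> > 0\<close> by (intro mult_nonneg_nonneg) auto
  then show ?thesis
    using s(3) by simp
qed

section \<open>The largest eigenvalue of a Gram matrix\<close>

lemma inner_gram: "((transpose X ** X) *v v) \<bullet> w = (X *v v) \<bullet> (X *v (w :: real ^ 'd))"
  for X :: "real ^ 'd ^ 'n"
  by (simp only: dot_lmul_matrix transpose_matrix_vector flip: matrix_vector_mul_assoc)

text \<open>Since \<open>lambda_max\<close> is a \<open>GREATEST\<close>, a largest eigenvalue must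
  first be exhibited. A maximiser of \<open>(norm (X *v v))\<^sup>2\<close> on the compact unit
  sphere is an eigenvector, and its value bounds every other eigenvalue.\<close>

lemma norm_le_lambda_max_gram:
  fixes X :: "real ^ 'd ^ 'n"
  shows "(norm (X *v v))\<^sup>2 \<le> lambda_max (transpose X ** X) * (norm v)\<^sup>2"
proof -
  let ?M = "transpose X ** X"
  have "continuous_on (sphere 0 1) (\<lambda>v :: real ^ 'd. (norm (X *v v))\<^sup>2)"
    by (intro continuous_intros linear_continuous_on linear_conv_bounded_linear[THEN iffD1]) auto
  moreover have "axis undefined 1 \<in> sphere (0 :: real ^ 'd) 1"
    by simp
  ultimately obtain v0 :: "real ^ 'd" where v0: "norm v0 = 1"
    and max: "\<And>v. norm v = 1 \<Longrightarrow> (norm (X *v v))\<^sup>2 \<le> (norm (X *v v0))\<^sup>2"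
    using continuous_attains_sup[of "sphere (0 :: real ^ 'd) 1" "\<lambda>v. (norm (X *v v))\<^sup>2"] by force
  have "v0 \<bullet> v0 = 1"
    using v0 by (simp add: dot_square_norm)
  define l where "l = (norm (X *v v0))\<^sup>2"
  have le: "(norm (X *v v))\<^sup>2 \<le> l * (norm v)\<^sup>2" for v
  proof (cases "v = 0")
    case False
    then have "(norm (X *v v) / norm v)\<^sup>2 \<le> l"
      using max[of "v /\<^sub>R norm v"]
      by (simp add: l_def matrix_vector_mult_scaleR divide_inverse mult.commute)
    then show ?thesis
      using False by (simp add: power_divide field_simps)
  qed simp
  text \<open>The positive semidefinite form \<open>l \<parallel>v\<parallel>\<^sup>2 - \<parallel>X v\<parallel>\<^sup>2\<close> vanishes at \<open>v0\<close>, so \<open>v0\<close> lies in its kernel.\<close>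
  have "?M *v v0 = l *\<^sub>R v0"
  proof -
    define w where "w = l *\<^sub>R v0 - ?M *v v0"
    define q where "q = l * (norm w)\<^sup>2 - (norm (X *v w))\<^sup>2"
    \<comment> \<open>The form evaluated at \<open>v0 + t *\<^sub>R w\<close>: the constant term
      vanishes and the linear coefficient is twice \<open>(norm w)\<^sup>2\<close>. Small negative
      \<open>t\<close> would make it negative unless \<open>w = 0\<close>.\<close>
    have form: "0 \<le> 2 * t * (norm w)\<^sup>2 + t\<^sup>2 * q" for t
    proof -
      have "(norm w)\<^sup>2 = l * (v0 \<bullet> w) - (X *v v0) \<bullet> (X *v w)"
        unfolding power2_norm_eq_inner
        by (subst (1) w_def) (simp add: inner_diff_left inner_gram)
      moreover have "(norm (X *v (v0 + t *\<^sub>R w)))\<^sup>2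
          = l + 2 * t * ((X *v v0) \<bullet> (X *v w)) + t\<^sup>2 * (norm (X *v w))\<^sup>2"
        unfolding l_def power2_norm_eq_inner matrix_vector_right_distrib matrix_vector_mult_scaleR
        by (simp add: inner_add_left inner_add_right inner_commute[of "X *v w" "X *v v0"] power2_eq_square distrib_left)
      moreover have "(norm (v0 + t *\<^sub>R w))\<^sup>2
          = 1 + 2 * t * (v0 \<bullet> w) + t\<^sup>2 * (norm w)\<^sup>2"
        unfolding power2_norm_eq_inner
        using \<open>v0 \<bullet> v0 = 1\<close> by (simp add: inner_add_left inner_add_right inner_commute[of w v0] power2_eq_square distrib_left)
      ultimately have "2 * t * (norm w)\<^sup>2 + t\<^sup>2 * q = l * (norm (v0 + t *\<^sub>R w))\<^sup>2 - (norm (X *v (v0 + t *\<^sub>R w)))\<^sup>2"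
        unfolding q_def by algebra
      then show ?thesis
        using le[of "v0 + t *\<^sub>R w"] by simp
    qed
    have q: "q \<ge> 0"
      using le[of w] by (simp add: q_def)
    \<comment> \<open>Take \<open>t = - (norm w)\<^sup>2 / (1 + q)\<close>; the summand 1 covers
      \<open>q = 0\<close>, and the factor \<open>(1 + q)\<^sup>2\<close> clears
      denominators.\<close>
    have "0 \<le> (2 * (- (norm w)\<^sup>2 / (1 + q)) * (norm w)\<^sup>2 + (- (norm w)\<^sup>2 / (1 + q))\<^sup>2 * q) * (1 + q)\<^sup>2"
      by (rule mult_nonneg_nonneg[OF form zero_le_power2])
    also have "\<dots> = - ((2 + q) * ((norm w)\<^sup>2)\<^sup>2)"
    proof -
      have "(2 * (- N / c) * N + (- N / c)\<^sup>2 * q) * c\<^sup>2 = - ((2 * c - q) * N\<^sup>2)" if "c > 0" for N c :: real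
        using that by (simp add: field_simps power2_eq_square)
      from this[of "1 + q"] show ?thesis
        using q by simp
    qed
    finally have "(norm w)\<^sup>2 = 0"
      using q by (simp add: mult_le_0_iff)
    then show ?thesis
      by (simp add: w_def)
  qed
  then have "is_eigenvalue ?M l"
    using v0 unfolding is_eigenvalue_def by (intro exI[of _ v0]) auto
  moreover have "k \<le> l" if "is_eigenvalue ?M k" for k
  proof -
    from that obtain v where v: "v \<noteq> 0" "?M *v v = k *\<^sub>R v"
      by (auto simp: is_eigenvalue_def)
    have "k * (norm v)\<^sup>2 = (norm (X *v v))\<^sup>2"
      using inner_gram[of X v v] v by (simp add: power2_norm_eq_inner)
    then have "k * (norm v)\<^sup>2 \<le> l * (norm v)\<^sup>2"
      using le[of v] by simp
    then show ?thesis
      using v(1) by (simp add: mult_le_cancel_right)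
  qed
  ultimately have "lambda_max ?M = l"
    unfolding lambda_max_def by (intro Greatest_equality) auto
  then show ?thesis
    using le by simp
qed

section \<open>The policy gradient iteration\<close>

text \<open>In logit space the step moves along \<open>X *v g\<close>. Its inner product with
  \<open>G\<close> is \<open>(norm g)\<^sup>2\<close> by adjointness, while its squared norm is at
  most \<open>lambda_max\<close> times that, so the condition of \<open>softmax_ascent\<close>
  reduces to the bound on \<open>\<eta>\<close>.\<close>

lemma pg_step_ascent:
  fixes X :: "real ^ 'd ^ 'n"
  assumes r: "\<And>a. \<bar>r $ a\<bar> \<le> R" and "\<eta> > 0"
    and \<eta>: "\<eta> * (2 * R * lambda_max (transpose X ** X)) \<le> 1"
  shows "policy X \<theta> \<bullet> r \<le> policy X (pg_step \<eta> X r \<theta>) \<bullet> r"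
proof -
  define G where "G = (diag (policy X \<theta>) - outer (policy X \<theta>) (policy X \<theta>)) *v r"
  define g where "g = transpose X *v G"
  have "R \<ge> 0"
    using r[of undefined] by linarith
  then have "\<eta> * (2 * R * (norm (X *v g))\<^sup>2) \<le> \<eta> * (2 * R * (lambda_max (transpose X ** X) * (norm g)\<^sup>2))"
    using \<open>\<eta> > 0\<close> norm_le_lambda_max_gram[of X g] by (intro mult_left_mono) auto
  also have "\<dots> = \<eta> * (2 * R * lambda_max (transpose X ** X)) * (norm g)\<^sup>2"
    by simp
  also have "\<dots> \<le> 1 * (norm g)\<^sup>2"
    using \<eta> by (intro mult_right_mono) auto
  also have "\<dots> = G \<bullet> (X *v g)"
    by (simp add: power2_norm_eq_inner g_def dot_lmul_matrix transpose_matrix_vector)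
  finally have "softmax (X *v \<theta>) \<bullet> r \<le> softmax (X *v \<theta> + \<eta> *\<^sub>R (X *v g)) \<bullet> r"
    by (intro softmax_ascent[OF r \<open>\<eta> > 0\<close>]) (simp_all add: G_def policy_def)
  then show ?thesis
    by (simp add: pg_step_def Let_def policy_def g_def G_def matrix_vector_right_distrib
        matrix_vector_mult_scaleR)
qed

lemma lambda_max_gram_nonneg: "lambda_max (transpose X ** X) \<ge> 0"
  for X :: "real ^ 'd ^ 'n"
  using order_trans[OF zero_le_power2 norm_le_lambda_max_gram[of X "axis undefined 1"]] by simp

text \<open>The normalising sum cancels, so a ratio of two probabilities is governed by a single
  linear functional of \<open>\<theta>\<close>.\<close>

lemma policy_ratio:
  "policy X \<theta> $ a = exp ((X $ a - X $ b) \<bullet> \<theta>) * policy X \<theta> $ b"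
  unfolding policy_def
  by (subst softmax_ratio[of _ a b]) (simp add: matrix_vector_mul_component inner_diff_left)

lemma policy_gradient_inner_three:
  fixes X :: "real ^ 'd ^ 3" and r :: "real ^ 3" and \<theta> :: "real ^ 'd"
  defines "J \<equiv> policy X \<theta> \<bullet> r"
  shows "(pg_step \<eta> X r \<theta> - \<theta>) \<bullet> u
    = \<eta> * (policy X \<theta> $ 1 * (r $ 1 - J) * ((X $ 1 - X $ 2) \<bullet> u)
           - policy X \<theta> $ 3 * (J - r $ 3) * ((X $ 3 - X $ 2) \<bullet> u))"
proof -
  let ?p = "policy X \<theta>"
  let ?G = "(diag ?p - outer ?p ?p) *v r"
  have "?p $ 1 + ?p $ 2 + ?p $ 3 = 1"
    using sum_softmax[of "X *v \<theta>"] by (simp add: policy_def sum_3)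
  moreover have "J = ?p $ 1 * r $ 1 + ?p $ 2 * r $ 2 + ?p $ 3 * r $ 3"
    by (simp add: J_def inner_vec_def sum_3)
  \<comment> \<open>The gradient coordinates \<open>?p $ a * (r $ a - J)\<close> sum to zero, which
    eliminates action 2 and leaves only differences of feature rows.\<close>
  ultimately have *: "?p $ 2 * (r $ 2 - J) = - (?p $ 1 * (r $ 1 - J)) - ?p $ 3 * (r $ 3 - J)"
    by algebra
  have "(pg_step \<eta> X r \<theta> - \<theta>) \<bullet> u = \<eta> * (?G \<bullet> (X *v u))"
    by (simp add: pg_step_def Let_def dot_lmul_matrix transpose_matrix_vector)
  also have "?G \<bullet> (X *v u) = (\<Sum>a\<in>UNIV. ?p $ a * (r $ a - J) * (X $ a \<bullet> u))"
    unfolding inner_vec_def[of "_ *v _"] softmax_gradient_nth J_def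
    by (simp add: matrix_vector_mul_component)
  also have "\<dots> = ?p $ 1 * (r $ 1 - J) * ((X $ 1 - X $ 2) \<bullet> u)
           - ?p $ 3 * (J - r $ 3) * ((X $ 3 - X $ 2) \<bullet> u)"
    unfolding sum_3 * by (simp add: inner_diff_left algebra_simps)
  finally show ?thesis .
qed

text \<open>Strictness holds because softmax gives every action positive probability. The upper
  bound makes the denominator in \<zeta> positive.\<close>

lemma policy_inner_strict_bounds:
  fixes X :: "real ^ 'd ^ 3" and r :: "real ^ 3"
  assumes "r $ 1 > r $ 2" "r $ 2 > r $ 3"
  shows "r $ 3 < policy X \<theta> \<bullet> r" "policy X \<theta> \<bullet> r < r $ 1"
proof -
  let ?p = "policy X \<theta>"
  have p: "?p $ a > 0" for a
    by (simp add: policy_def softmax_pos)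
  have s: "?p $ 2 = 1 - ?p $ 1 - ?p $ 3"
    using sum_softmax[of "X *v \<theta>"] by (simp add: policy_def sum_3)
  have J: "?p \<bullet> r = ?p $ 1 * r $ 1 + ?p $ 2 * r $ 2 + ?p $ 3 * r $ 3"
    by (simp add: inner_vec_def sum_3)
  have "?p \<bullet> r - r $ 3 = ?p $ 1 * (r $ 1 - r $ 3) + ?p $ 2 * (r $ 2 - r $ 3)"
    unfolding J s by (simp add: algebra_simps)
  also have "\<dots> > 0"
    using assms p by (intro add_pos_pos mult_pos_pos) auto
  finally show "r $ 3 < ?p \<bullet> r" by simp
  have "r $ 1 - ?p \<bullet> r = ?p $ 2 * (r $ 1 - r $ 2) + ?p $ 3 * (r $ 1 - r $ 3)"
    unfolding J s by (simp add: algebra_simps)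
  also have "\<dots> > 0"
    using assms p by (intro add_pos_pos mult_pos_pos) auto
  finally show "?p \<bullet> r < r $ 1" by simp
qed

theorem proposition13:
  fixes X :: "real ^ 'd ^ 3" and r :: "real ^ 3" and \<theta> :: "nat \<Rightarrow> real ^ 'd"
    and Rmax C \<zeta> \<eta> :: real
  assumes "Rmax > 0"
    and "\<forall>i. r $ i \<in> {- Rmax..Rmax}"
    and "r $ 1 > r $ 2" and "r $ 2 > r $ 3"
    and "\<exists>w. \<forall>i j. (X *v w) $ i > (X *v w) $ j \<longleftrightarrow> r $ i > r $ j"
    and "\<not> (X $ 2 - X $ 3) \<bullet> (X $ 1 - X $ 3) > 0"
    and "\<theta> 1 = C *\<^sub>R (X $ 3 - X $ 1)"
    and "\<zeta> = ((X $ 3 - X $ 2) \<bullet> (X $ 1 - X $ 3)) / ((X $ 1 - X $ 2) \<bullet> (X $ 1 - X $ 3))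
             * ((policy X (\<theta> 1) \<bullet> r - r $ 3) / (r $ 1 - policy X (\<theta> 1) \<bullet> r))"
    and "\<zeta> > 0" \<comment> \<open>so that \<open>ln \<zeta>\<close> below is the genuine logarithm and not the library value \<open>ln 0 = 0\<close>\<close>
    and "C > - ln \<zeta> / (norm (X $ 3 - X $ 1))\<^sup>2"
    and "0 < \<eta>" and "\<eta> < 4 / (9 * Rmax * lambda_max (transpose X ** X))"
    and "\<forall>t\<ge>1. \<theta> (t + 1) = pg_step \<eta> X r (\<theta> t)"
  shows "\<not> (\<lambda>t. policy X (\<theta> t) $ 1) \<longlonglongrightarrow> 1"
proof -
  define u where "u = X $ 1 - X $ 3"
  define A where "A = (X $ 3 - X $ 2) \<bullet> u"
  define B where "B = (X $ 1 - X $ 2) \<bullet> u"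
  define J where "J t = policy X (\<theta> t) \<bullet> r" for t
  \<comment> \<open>The ratio of the probabilities of actions 1 and 3 at the initialization, where
    \<open>\<theta> 1 = - C *\<^sub>R u\<close>.\<close>
  define \<rho> where "\<rho> = exp (- C * (norm u)\<^sup>2)"
  note J_bounds = policy_inner_strict_bounds[OF assms(3,4), of X]
  have r: "\<bar>r $ a\<bar> \<le> Rmax" for a
    using assms(2) by (auto simp: abs_le_iff minus_le_iff)
  \<comment> \<open>If rows 1 and 3 coincided, no \<open>w\<close> could rank action 1 above action
    3.\<close>
  have "u \<noteq> 0"
  proof
    assume "u = 0"
    then have "(X *v w) $ 1 = (X *v w) $ 3" for w
      by (simp add: u_def matrix_vector_mul_component)
    then show False
      using assms(3-5) by (metis less_irrefl less_trans)
  qed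
  have A: "A \<ge> 0"
    using assms(6) by (simp add: A_def u_def inner_diff_left)
  \<comment> \<open>Split \<open>X $ 1 - X $ 2\<close> as
    \<open>u + (X $ 3 - X $ 2)\<close>.\<close>
  have "B = (norm u)\<^sup>2 + A"
    by (simp add: A_def B_def u_def power2_norm_eq_inner inner_diff_left)
  then have B: "B > 0"
    using A \<open>u \<noteq> 0\<close> by (simp add: add_pos_nonneg)
  \<comment> \<open>The condition on \<open>C\<close>, exponentiated;
    \<open>exp (ln \<zeta>) = \<zeta>\<close> relies on \<open>\<zeta> > 0\<close>.\<close>
  have "\<rho> < \<zeta>"
  proof -
    have "- C * (norm u)\<^sup>2 < ln \<zeta>"
      using assms(10) \<open>u \<noteq> 0\<close> pos_divide_less_eq[of "(norm u)\<^sup>2" "- ln \<zeta>" C]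
      unfolding norm_minus_commute[of "X $ 3"] u_def[symmetric] by simp
    then show ?thesis
      using \<open>\<zeta> > 0\<close> by (metis \<rho>_def exp_less_mono exp_ln)
  qed
  \<comment> \<open>The previous bound with the denominators of \<zeta> cleared. In this form,
    increasing \<open>J\<close> lowers the left side and raises the right side.\<close>
  have \<rho>_initial: "\<rho> * B * (r $ 1 - J 1) \<le> A * (J 1 - r $ 3)"
  proof -
    have pos: "r $ 1 - J 1 > 0"
      using J_bounds[of "\<theta> 1"] by (simp add: J_def)
    have "\<rho> * B * (r $ 1 - J 1) \<le> \<zeta> * B * (r $ 1 - J 1)"
      using \<open>\<rho> < \<zeta>\<close> B pos by (intro mult_right_mono) auto
    also have "\<zeta> = A / B * ((J 1 - r $ 3) / (r $ 1 - J 1))"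
      using assms(8) by (simp only: A_def B_def J_def u_def)
    also have "\<dots> * B * (r $ 1 - J 1) = A * (J 1 - r $ 3)"
      using B pos by simp
    finally show ?thesis .
  qed
  have \<eta>: "\<eta> * (2 * Rmax * lambda_max (transpose X ** X)) \<le> 1"
  proof -
    \<comment> \<open>If \<open>lambda_max\<close> were 0, division by zero would make the upper
      bound on \<open>\<eta>\<close> equal to 0, contradicting \<open>0 < \<eta>\<close>. The
      resulting 4/9 lies below the 1/2 required for ascent.\<close>
    have "\<eta> * (9 * Rmax * lambda_max (transpose X ** X)) < 4"
      using assms(1,11,12) lambda_max_gram_nonneg[of X]
      by (cases "lambda_max (transpose X ** X) = 0") (auto simp: field_simps)
    moreover have "\<eta> * (Rmax * lambda_max (transpose X ** X)) \<ge> 0"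
      using assms(1,11) lambda_max_gram_nonneg[of X] by simp
    ultimately show ?thesis by linarith
  qed
  \<comment> \<open>Both parts are carried together: the ratio bound at \<open>t\<close> and
    \<open>J 1 \<le> J t\<close> give the sign of the next increment along \<open>u\<close>, while
    ascent preserves the second part.\<close>
  have inv: "u \<bullet> \<theta> t \<le> - C * (norm u)\<^sup>2 \<and> J 1 \<le> J t" if "t \<ge> 1" for t
    using that
  proof (induction t rule: dec_induct)
    case base
    have "\<theta> 1 = - C *\<^sub>R u"
      unfolding assms(7) u_def by (simp add: scaleR_diff_right)
    then show ?case
      unfolding power2_norm_eq_inner by simp
  next
    case (step t)
    have step_eq: "\<theta> (Suc t) = pg_step \<eta> X r (\<theta> t)"
      using assms(13) step.hyps by simp
    have "J t \<le> J (Suc t)"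
      unfolding J_def step_eq by (rule pg_step_ascent[OF r assms(11) \<eta>])
    moreover have "(\<theta> (Suc t) - \<theta> t) \<bullet> u \<le> 0"
    proof -
      let ?p = "policy X (\<theta> t)"
      have p3: "?p $ 3 > 0"
        by (simp add: policy_def softmax_pos)
      have "?p $ 1 \<le> \<rho> * ?p $ 3"
        using policy_ratio[of X "\<theta> t" 1 3] step.IH p3 by (simp add: \<rho>_def u_def)
      then have "?p $ 1 * (B * (r $ 1 - J t)) \<le> \<rho> * ?p $ 3 * (B * (r $ 1 - J t))"
        using B J_bounds(2)[of "\<theta> t"] by (intro mult_right_mono) (auto simp: J_def)
      also have "\<dots> = ?p $ 3 * (\<rho> * B * (r $ 1 - J t))"
        by simp
      also have "\<dots> \<le> ?p $ 3 * (A * (J t - r $ 3))"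
      proof (rule mult_left_mono)
        have "\<rho> * B * (r $ 1 - J t) \<le> \<rho> * B * (r $ 1 - J 1)"
          using step.IH B by (intro mult_left_mono) (auto simp: \<rho>_def)
        also note \<rho>_initial
        also have "A * (J 1 - r $ 3) \<le> A * (J t - r $ 3)"
          using step.IH A by (intro mult_left_mono) auto
        finally show "\<rho> * B * (r $ 1 - J t) \<le> A * (J t - r $ 3)" .
      qed (use p3 in simp)
      finally have "?p $ 1 * (r $ 1 - J t) * B - ?p $ 3 * (J t - r $ 3) * A \<le> 0"
        by (simp add: mult_ac)
      then show ?thesis
        using assms(11) unfolding step_eq policy_gradient_inner_three
        by (simp add: A_def B_def J_def mult_le_0_iff)
    qed
    ultimately show ?case
      using step.IH unfolding inner_commute[of _ u] inner_diff_right by simp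
  qed
  have "policy X (\<theta> t) $ 1 \<le> \<rho> / (1 + \<rho>)" if "t \<ge> 1" for t
  proof -
    let ?p = "policy X (\<theta> t)"
    have p: "?p $ a > 0" for a
      by (simp add: policy_def softmax_pos)
    have "?p $ 1 \<le> \<rho> * ?p $ 3"
      using policy_ratio[of X "\<theta> t" 1 3] inv[OF that] p[of 3] by (simp add: \<rho>_def u_def)
    \<comment> \<open>Action 3 has at most the mass not on action 1; solving for
      \<open>?p $ 1\<close> gives a bound below 1 independent of \<open>t\<close>.\<close>
    also have "\<dots> \<le> \<rho> * (1 - ?p $ 1)"
      using sum_softmax[of "X *v \<theta> t"] p[of 2]
      by (intro mult_left_mono) (auto simp: \<rho>_def policy_def sum_3)
    finally have "?p $ 1 * (1 + \<rho>) \<le> \<rho>"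
      by (simp add: algebra_simps)
    then show ?thesis
      using pos_le_divide_eq[of "1 + \<rho>" "?p $ 1" \<rho>] by (simp add: \<rho>_def add_pos_pos)
  qed
  then have "1 \<le> \<rho> / (1 + \<rho>)" if "(\<lambda>t. policy X (\<theta> t) $ 1) \<longlonglongrightarrow> 1"
    using that by (intro LIMSEQ_le_const2) auto
  moreover have "\<rho> / (1 + \<rho>) < 1"
    by (simp add: \<rho>_def add_pos_pos)
  ultimately show ?thesis by linarith
qed

end
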